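(* Let $k\ge 1$ and let $\Sigma$ be a finite non-empty alphabet. For any two words $u,v\in\Sigma^*$, we have $u\sim_k v$ if and only if $u\,R_k^*\,v$, where $R_k^*$ is the reflexive and transitive closure of the $k$-switching relation $R_k$.
   Context: For a word $u$ and a non-empty word $x$, $|u|_x$ is the number of occurrences (overlapping ones included) of $x$ as a factor of $u$. Two words $u,v\in\Sigma^*$ are $k$-abelian equivalent, $u\sim_k v$, if $|u|_x=|v|_x$ for every non-empty word $x\in\Sigma^*$ of length at most $k$. For a word $u=a_1\cdots a_n$ write $u[i,j)=a_i\cdots a_{j-1}$ (the empty word if $i\ge j$) and $u[i..]=a_i\cdots a_n$. Let $i,j,l,m$ be indices with $1\le i<j\le l<m\le n-k+2$ such that $u[i,i+k-1)=u[l,l+k-1)$ and $u[j,j+k-1)=u[m,m+k-1)$ (these are words of length $k-1$; for $k=1$ they are empty). The $k$-switching on $u$ with these indices is the word $$S_{u,k}(i,j,l,m)=u[1,i)\cdot u[l,m)\cdot u[j,l)\cdot u[i,j)\cdot u[m..].$$ The relation $R_k$ on $\Sigma^*$ is defined by: $u\,R_k\,v$ if and only if $v=S_{u,k}(i,j,l,m)$ for some $k$-switching on $u$. *)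

theory Defs
  imports Main
begin

text \<open>Words are lists. Positions in a word are numbered from 1.\<close>

definition occurrences :: "'a list \<Rightarrow> 'a list \<Rightarrow> nat" where
  "occurrences u x = card {p. p + length x \<le> length u \<and> take (length x) (drop p u) = x}"

definition k_abelian_equiv :: "'a set \<Rightarrow> nat \<Rightarrow> 'a list \<Rightarrow> 'a list \<Rightarrow> bool" where
  "k_abelian_equiv \<Sigma> k u v \<longleftrightarrow>
     (\<forall>x \<in> lists \<Sigma>. x \<noteq> [] \<and> length x \<le> k \<longrightarrow> occurrences u x = occurrences v x)"

text \<open>\<open>factor u i j\<close> is \<open>u[i,j)\<close>, meant for \<open>i \<ge> 1\<close>; it is empty for \<open>i \<ge> j\<close>
  because subtraction is truncated. \<open>suffix_from u i\<close> is \<open>u[i..]\<close>.\<close>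

definition factor :: "'a list \<Rightarrow> nat \<Rightarrow> nat \<Rightarrow> 'a list" where
  "factor u i j = take (j - i) (drop (i - 1) u)"

definition suffix_from :: "'a list \<Rightarrow> nat \<Rightarrow> 'a list" where
  "suffix_from u i = drop (i - 1) u"

text \<open>The bound \<open>m \<le> n - k + 2\<close>, read over the integers, is written as \<open>m + k \<le> n + 2\<close>.\<close>

definition switching_indices :: "'a list \<Rightarrow> nat \<Rightarrow> nat \<Rightarrow> nat \<Rightarrow> nat \<Rightarrow> nat \<Rightarrow> bool" where
  "switching_indices u k i j l m \<longleftrightarrow>
     1 \<le> i \<and> i < j \<and> j \<le> l \<and> l < m \<and> m + k \<le> length u + 2 \<and>
     factor u i (i + k - 1) = factor u l (l + k - 1) \<and>
     factor u j (j + k - 1) = factor u m (m + k - 1)"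

definition switching :: "'a list \<Rightarrow> nat \<Rightarrow> nat \<Rightarrow> nat \<Rightarrow> nat \<Rightarrow> 'a list" where
  "switching u i j l m =
     factor u 1 i @ factor u l m @ factor u j l @ factor u i j @ suffix_from u m"

definition switching_rel :: "'a set \<Rightarrow> nat \<Rightarrow> ('a list \<times> 'a list) set" where
  "switching_rel \<Sigma> k =
     {(u, v). u \<in> lists \<Sigma> \<and> v \<in> lists \<Sigma> \<and>
        (\<exists>i j l m. switching_indices u k i j l m \<and> v = switching u i j l m)}"

end

theory Submission
  imports Defs "HOL-Library.Sublist"
begin

text \<open>
  Put \<open>d = k - 1\<close> and read a word as a walk in the de Bruijn graph: the vertex at a position is the
  factor of length \<open>d\<close> starting there, and the edges are the factors of length \<open>k\<close>. A \<open>k\<close>-switching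
  cuts the walk at two visits of a vertex \<open>s\<close> and two visits of a vertex \<open>t\<close>, interleaved as
  \<open>s, t, s, t\<close>, and exchanges the two stretches from \<open>s\<close> to \<open>t\<close>. In terms of words it turns
  \<open>A B C D E\<close> into \<open>A D C B E\<close>. The walk uses the same edges as often as before, so all factor
  counts up to length \<open>k\<close> are preserved (\<open>occurrences_block_swap\<close>).

  Conversely, the count of \<open>x\<close> exceeds the total count of the words \<open>a x\<close> (\<open>a\<close> a letter) by one if
  \<open>x\<close> is a prefix, and equals it otherwise, so \<open>k\<close>-abelian equivalent words begin at
  the same vertex and have the same edges with multiplicity. The words are then made equal letter by letter from the left. Suppose
  that the first edges differ, \<open>e\<close> in \<open>u\<close> and \<open>f\<close> in \<open>v\<close>. The edge \<open>f\<close> is used by \<open>u\<close> at a later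
  position \<open>q\<close>. If a vertex visited by \<open>u\<close> after its start and no later than \<open>q\<close> is visited again
  after \<open>q\<close>, then one switching brings \<open>f\<close> to the front. Otherwise the vertices visited after \<open>q\<close>
  are disjoint from the earlier ones, and no edge leads back. But \<open>v\<close> begins with \<open>f\<close>, which crosses
  into the later part, so \<open>v\<close> could never use \<open>e\<close>, which starts at an earlier
  vertex: a contradiction (\<open>block_swap_first_edge\<close>).
\<close>

section \<open>Counting occurrences\<close>

lemma occurrences_Nil: "x \<noteq> [] \<Longrightarrow> occurrences [] x = 0"
  by (simp add: occurrences_def)

lemma occurs_at_iff_prefix:
  "p + length x \<le> length u \<and> take (length x) (drop p u) = x
     \<longleftrightarrow> p \<le> length u \<and> prefix x (drop p u)"
proof
  assume "p + length x \<le> length u \<and> take (length x) (drop p u) = x"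
  then show "p \<le> length u \<and> prefix x (drop p u)"
    by (metis add_leD1 take_is_prefix)
next
  assume *: "p \<le> length u \<and> prefix x (drop p u)"
  then have "length x \<le> length u - p" using prefix_length_le by fastforce
  with * show "p + length x \<le> length u \<and> take (length x) (drop p u) = x"
    by (auto simp: prefix_def)
qed

lemma occurrences_prefix:
  "occurrences u x = card {p. p \<le> length u \<and> prefix x (drop p u)}"
  unfolding occurrences_def occurs_at_iff_prefix ..

lemma occurrences_Cons:
  assumes "x \<noteq> []"
  shows "occurrences (a # u) x = of_bool (prefix x (a # u)) + occurrences u x"
proof -
  let ?P = "{p. p \<le> length u \<and> prefix x (drop p u)}"
  have "p \<in> {p. p \<le> length (a # u) \<and> prefix x (drop p (a # u))}
      \<longleftrightarrow> p \<in> (if prefix x (a # u) then {0} else {}) \<union> Suc ` ?P" for p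
    by (cases p) auto
  then have "{p. p \<le> length (a # u) \<and> prefix x (drop p (a # u))} =
      (if prefix x (a # u) then {0} else {}) \<union> Suc ` ?P"
    by blast
  moreover have "card (Suc ` ?P) = card ?P" by (simp add: card_image)
  ultimately show ?thesis
    unfolding occurrences_prefix by (simp add: card_insert_if)
qed

lemma occurrences_pos_iff:
  "occurrences u x > 0 \<longleftrightarrow> (\<exists>p \<le> length u. prefix x (drop p u))"
proof -
  have "finite {p. p \<le> length u \<and> prefix x (drop p u)}" by simp
  then show ?thesis unfolding occurrences_prefix card_gt_0_iff by auto
qed

lemma occurrences_pos_subset: "occurrences u x > 0 \<Longrightarrow> set x \<subseteq> set u"
  unfolding occurrences_pos_iff by (meson set_drop_subset set_mono_prefix order_trans)

text \<open>Every occurrence of \<open>x\<close> is preceded by a letter, except one at the very start.\<close>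

lemma occurrences_left_extension:
  assumes "finite \<Sigma>" "u \<in> lists \<Sigma>" "x \<noteq> []"
  shows "occurrences u x = of_bool (prefix x u) + (\<Sum>a\<in>\<Sigma>. occurrences u (a # x))"
  using assms(2)
proof (induction u)
  case Nil
  then show ?case using assms(3) by (simp add: occurrences_Nil)
next
  case (Cons b u)
  have "(\<Sum>a\<in>\<Sigma>. of_bool (a = b \<and> prefix x u)) = (of_bool (prefix x u) :: nat)"
    using assms(1) Cons.hyps by (simp add: of_bool_conj sum.delta flip: sum_distrib_right)
  then have "(\<Sum>a\<in>\<Sigma>. occurrences (b # u) (a # x)) =
      of_bool (prefix x u) + (\<Sum>a\<in>\<Sigma>. occurrences u (a # x))"
    by (simp add: occurrences_Cons sum.distrib)
  with Cons.IH show ?case using assms(3) by (simp add: occurrences_Cons)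
qed

lemma prefix_iff_prefix_take:
  "length x \<le> n \<Longrightarrow> prefix x u \<longleftrightarrow> prefix x (take n u)"
  by (simp add: prefix_def)
    (metis append_take_drop_id append.assoc append_eq_conv_conj min.absorb1 take_take)

text \<open>
  The previous identity expresses whether \<open>x\<close> is a prefix through counts of words one letter
  longer at most. Applied to \<open>take d u\<close> and \<open>take d v\<close>, it shows that each is a prefix of
  the other.
\<close>

lemma same_start:
  assumes "finite \<Sigma>" "u \<in> lists \<Sigma>" "v \<in> lists \<Sigma>"
    and eq: "k_abelian_equiv \<Sigma> (Suc d) u v"
  shows "take d u = take d v"
proof -
  have iff: "prefix x u \<longleftrightarrow> prefix x v" if "x \<in> lists \<Sigma>" "length x \<le> d" for x
  proof (cases "x = []")
    case False
    have "(\<Sum>a\<in>\<Sigma>. occurrences u (a # x)) = (\<Sum>a\<in>\<Sigma>. occurrences v (a # x))"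
      using eq that by (intro sum.cong) (auto simp: k_abelian_equiv_def)
    moreover have "occurrences u x = occurrences v x"
      using eq that False by (auto simp: k_abelian_equiv_def)
    ultimately have "of_bool (prefix x u) = (of_bool (prefix x v) :: nat)"
      using occurrences_left_extension[OF assms(1,2) False]
        occurrences_left_extension[OF assms(1,3) False] by simp
    then show ?thesis by (simp only: of_bool_eq_iff)
  qed simp
  have "prefix (take d u) v"
    using iff[of "take d u"] assms(2) by (auto simp: take_is_prefix dest: in_set_takeD)
  moreover have "prefix (take d v) u"
    using iff[of "take d v"] assms(3) by (auto simp: take_is_prefix dest: in_set_takeD)
  ultimately have "prefix (take d u) (take d v)" "prefix (take d v) (take d u)"
    using prefix_iff_prefix_take[of "take d u" d v] prefix_iff_prefix_take[of "take d v" d u]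
    by simp_all
  then show ?thesis by (simp add: prefix_order.antisym)
qed


section \<open>Switchings as exchanges of blocks\<close>

text \<open>
  With \<open>d = k - 1\<close>, the blocks are the pieces of the word between the four indices of a
  \<open>k\<close>-switching. The conditions on \<open>take d\<close> say that the walk is at the same vertex before \<open>B\<close> and
  before \<open>D\<close>, and at the same vertex before \<open>C\<close> and before \<open>E\<close>.
\<close>

definition block_swap :: "nat \<Rightarrow> 'a list \<Rightarrow> 'a list \<Rightarrow> bool" where
  "block_swap d u v \<longleftrightarrow> (\<exists>A B C D E.
     u = A @ B @ C @ D @ E \<and> v = A @ D @ C @ B @ E \<and> B \<noteq> [] \<and> D \<noteq> [] \<and> d \<le> length E \<and>
     take d (B @ C @ D @ E) = take d (D @ E) \<and> take d (C @ D @ E) = take d E)"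

lemma block_swap_set: "block_swap d u v \<Longrightarrow> set v = set u"
  unfolding block_swap_def by auto

lemma block_swap_Cons: "block_swap d u v \<Longrightarrow> block_swap d (a # u) (a # v)"
  unfolding block_swap_def by (metis append_Cons)

lemma block_swap_rtranclp_Cons:
  "(block_swap d)\<^sup>*\<^sup>* u v \<Longrightarrow> (block_swap d)\<^sup>*\<^sup>* (a # u) (a # v)"
  by (induction rule: rtranclp_induct)
    (auto intro: rtranclp.rtrancl_into_rtrancl block_swap_Cons)

lemma switching_imp_block_swap:
  assumes "switching_indices u (Suc d) i j l m"
  shows "block_swap d u (switching u i j l m)"
proof -
  have ix: "1 \<le> i" "i < j" "j \<le> l" "l < m" "m + d \<le> length u + 1"
    and s: "take d (drop (i - 1) u) = take d (drop (l - 1) u)"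
    and t: "take d (drop (j - 1) u) = take d (drop (m - 1) u)"
    using assms by (auto simp: switching_indices_def factor_def)
  have cut: "factor u p r @ drop (r - 1) u = drop (p - 1) u" if "1 \<le> p" "p \<le> r" for p r
  proof -
    have "r - p + (p - 1) = r - 1" using that by simp
    then show ?thesis
      unfolding factor_def by (metis append_take_drop_id drop_drop)
  qed
  let ?A = "factor u 1 i" and ?B = "factor u i j" and ?C = "factor u j l"
    and ?D = "factor u l m" and ?E = "drop (m - 1) u"
  have D: "?D @ ?E = drop (l - 1) u" and C: "?C @ ?D @ ?E = drop (j - 1) u"
    and B: "?B @ ?C @ ?D @ ?E = drop (i - 1) u" and A: "?A @ ?B @ ?C @ ?D @ ?E = u"
    using ix cut[of l m] cut[of j l] cut[of i j] cut[of 1 i] by auto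
  have "?B \<noteq> []" "?D \<noteq> []" "d \<le> length ?E"
    using ix by (auto simp: factor_def)
  then show ?thesis
    unfolding block_swap_def switching_def suffix_from_def
    using A B C D s t by metis
qed

lemma block_swap_imp_switching:
  assumes "block_swap d u v"
  shows "\<exists>i j l m. switching_indices u (Suc d) i j l m \<and> v = switching u i j l m"
proof -
  from assms obtain A B C D E where
    u: "u = A @ B @ C @ D @ E" and v: "v = A @ D @ C @ B @ E"
    and ne: "B \<noteq> []" "D \<noteq> []" and E: "d \<le> length E"
    and st: "take d (B @ C @ D @ E) = take d (D @ E)" "take d (C @ D @ E) = take d E"
    unfolding block_swap_def by blast
  define i where "i = Suc (length A)"
  define j where "j = i + length B"
  define l where "l = j + length C"
  define m where "m = l + length D"
  note defs = i_def j_def l_def m_def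
  have drops: "drop (i - 1) u = B @ C @ D @ E" "drop (j - 1) u = C @ D @ E"
    "drop (l - 1) u = D @ E" "drop (m - 1) u = E"
    by (simp_all add: u defs)
  have len: "j - i = length B" "l - j = length C" "m - l = length D" "i - 1 = length A"
    by (simp_all add: defs)
  have "switching_indices u (Suc d) i j l m"
    using ne E st drops unfolding switching_indices_def factor_def by (simp add: u defs)
  moreover have "v = switching u i j l m"
    unfolding switching_def factor_def suffix_from_def drops len v by (simp add: u)
  ultimately show ?thesis by blast
qed

lemma switching_rel_iff_block_swap:
  "(u, v) \<in> switching_rel \<Sigma> (Suc d) \<longleftrightarrow> u \<in> lists \<Sigma> \<and> v \<in> lists \<Sigma> \<and> block_swap d u v"
  unfolding switching_rel_def
  using switching_imp_block_swap block_swap_imp_switching by blast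


section \<open>Switchings preserve the counts\<close>

lemma take_append_cong: "take d w = take d z \<Longrightarrow> take d (a @ w) = take d (a @ z)"
  by (simp, metis diff_le_self min.absorb1 take_take)

lemma take_append_cong_nonempty:
  assumes "take d w = take d z" "a \<noteq> []"
  shows "take (Suc d) (a @ w) = take (Suc d) (a @ z)"
  using assms take_append_cong[of d w z "tl a"] by (cases a) auto

text \<open>
  The number of occurrences starting inside the block \<open>a\<close> depends only on \<open>a\<close> and on the next
  \<open>d\<close> letters. The additive form avoids subtraction.
\<close>

lemma occurrences_append_exchange:
  assumes "x \<noteq> []" "length x \<le> Suc d" "take d w = take d z"
  shows "occurrences (a @ w) x + occurrences z x = occurrences (a @ z) x + occurrences w x"
proof (induction a)
  case (Cons b a)
  have "take (Suc d) (b # a @ w) = take (Suc d) (b # a @ z)"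
    using take_append_cong_nonempty[OF assms(3), of "b # a"] by simp
  then have "prefix x (b # a @ w) \<longleftrightarrow> prefix x (b # a @ z)"
    using prefix_iff_prefix_take[OF assms(2)] by metis
  then show ?case using Cons assms(1) by (simp add: occurrences_Cons)
qed simp

lemma occurrences_block_swap:
  assumes "block_swap d u v" "x \<noteq> []" "length x \<le> Suc d"
  shows "occurrences u x = occurrences v x"
proof -
  from assms(1) obtain A B C D E where
    u: "u = A @ B @ C @ D @ E" and v: "v = A @ D @ C @ B @ E"
    and s: "take d (B @ C @ D @ E) = take d (D @ E)" and t: "take d (C @ D @ E) = take d E"
    unfolding block_swap_def by blast
  have s': "take d (B @ E) = take d (D @ E)"
    using s take_append_cong[OF t, of B] by simp
  have t': "take d (C @ B @ E) = take d E"
    using t take_append_cong[OF s', of C] by simp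
  have s'': "take d (D @ C @ B @ E) = take d (D @ E)"
    by (rule take_append_cong[OF t'])
  note ex = occurrences_append_exchange[OF assms(2,3)]
  \<comment> \<open>Each block contributes the same in both words, since the vertex that follows it is the same.\<close>
  have "occurrences (A @ B @ C @ D @ E) x + occurrences (D @ C @ B @ E) x
      = occurrences (A @ D @ C @ B @ E) x + occurrences (B @ C @ D @ E) x"
    using ex[of "B @ C @ D @ E" "D @ C @ B @ E" A] s s'' by simp
  moreover have "occurrences (D @ C @ B @ E) x + occurrences E x
      = occurrences (D @ E) x + occurrences (C @ B @ E) x"
    using ex[OF t', of D] by simp
  moreover have "occurrences (C @ B @ E) x + occurrences (D @ E) x
      = occurrences (C @ D @ E) x + occurrences (B @ E) x"
    using ex[OF s', of C] by simp
  moreover have "occurrences (B @ C @ D @ E) x + occurrences E x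
      = occurrences (B @ E) x + occurrences (C @ D @ E) x"
    using ex[OF t, of B] by simp
  ultimately show ?thesis unfolding u v by linarith
qed


section \<open>Equal counts imply connection by switchings\<close>

text \<open>
  Words of length \<open>Suc d\<close> are the edges of the de Bruijn graph. No alphabet is mentioned, so that
  the induction need not carry one along.
\<close>

definition same_edges :: "nat \<Rightarrow> 'a list \<Rightarrow> 'a list \<Rightarrow> bool" where
  "same_edges d u v \<longleftrightarrow> (\<forall>x. length x = Suc d \<longrightarrow> occurrences u x = occurrences v x)"

lemma same_edges_sym: "same_edges d u v \<Longrightarrow> same_edges d v u"
  by (simp add: same_edges_def)

lemma same_edge_same_ends:
  "take (Suc d) w = take (Suc d) z \<Longrightarrow> take d w = take d z \<and> take d (drop 1 w) = take d (drop 1 z)"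
  by (metis One_nat_def drop_take diff_Suc_1 min.absorb1 le_SucI order_refl take_take)

lemma same_edges_occurs:
  assumes "same_edges d u v" "p + d < length u"
  obtains q where "q + d < length v" "take (Suc d) (drop q v) = take (Suc d) (drop p u)"
proof -
  let ?x = "take (Suc d) (drop p u)"
  have len: "length ?x = Suc d" using assms(2) by simp
  have "p \<le> length u \<and> prefix ?x (drop p u)"
    using assms(2) by (simp add: take_is_prefix)
  then have "occurrences u ?x > 0" unfolding occurrences_pos_iff by blast
  then have "occurrences v ?x > 0" using assms(1) len by (simp add: same_edges_def)
  then obtain q where "q + length ?x \<le> length v \<and> take (length ?x) (drop q v) = ?x"
    unfolding occurrences_pos_iff using occurs_at_iff_prefix by blast
  then show ?thesis using that[of q] unfolding len by simp
qed

text \<open>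
  The heart of the argument. If no exchange brings the first edge \<open>f\<close> of \<open>v\<close> to the front of
  \<open>u\<close>, then \<open>f\<close> is a one-way passage in \<open>u\<close> at its position \<open>q\<close>, and \<open>v\<close>, which crosses it at once,
  can never use the first edge of \<open>u\<close>.
\<close>

lemma block_swap_first_edge:
  assumes edges: "same_edges d u v" and start: "take d u = take d v"
    and len: "d < length u" "d < length v"
    and diff: "take (Suc d) u \<noteq> take (Suc d) v"
  shows "\<exists>w. block_swap d u w \<and> take (Suc d) w = take (Suc d) v"
proof -
  obtain q where q: "q + d < length u" and f: "take (Suc d) (drop q u) = take (Suc d) v"
    using same_edges_occurs[OF same_edges_sym[OF edges], of 0] len by auto
  have "q > 0" using f diff by (cases q) auto
  have q_state: "take d (drop q u) = take d u"
    using same_edge_same_ends[OF f] start by simp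
  show ?thesis
  proof (cases "\<exists>j m. 0 < j \<and> j \<le> q \<and> q < m \<and> m + d \<le> length u \<and>
      take d (drop j u) = take d (drop m u)")
    case True
    then obtain j m where jm: "0 < j" "j \<le> q" "q < m" "m + d \<le> length u"
      and t: "take d (drop j u) = take d (drop m u)" by blast
    define B C D E where "B = take j u" and "C = take (q - j) (drop j u)"
      and "D = take (m - q) (drop q u)" and "E = drop m u"
    have DE: "D @ E = drop q u"
      using jm by (metis D_def E_def append_take_drop_id drop_drop le_add_diff_inverse2 less_imp_le)
    have CDE: "C @ D @ E = drop j u"
      using jm by (metis C_def DE append_take_drop_id drop_drop le_add_diff_inverse2)
    have BCDE: "B @ C @ D @ E = u" using CDE by (simp add: B_def)
    have ne: "B \<noteq> []" "D \<noteq> []" "d \<le> length E"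
      using jm by (auto simp: B_def D_def E_def)
    have s: "take d (B @ C @ D @ E) = take d (D @ E)" using BCDE DE q_state by simp
    have tE: "take d (C @ D @ E) = take d E" using CDE t by (simp add: E_def)
    let ?w = "D @ C @ B @ E"
    have "block_swap d u ?w"
      unfolding block_swap_def using BCDE ne s tE by (metis append_Nil)
    moreover have "take d (C @ B @ E) = take d E"
      using take_append_cong[OF tE, of B] s tE take_append_cong[of d "B @ E" "D @ E" C] by simp
    then have "take (Suc d) ?w = take (Suc d) v"
      using take_append_cong_nonempty[OF _ ne(2)] DE f by metis
    ultimately show ?thesis by blast
  next
    case False
    define later where "later = {take d (drop m u) | m. q < m \<and> m + d \<le> length u}"
    \<comment> \<open>Position \<open>0\<close> is covered too, as \<open>u\<close> visits the same vertex at \<open>0\<close> and at \<open>q\<close>.\<close>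
    have not_later: "take d (drop j u) \<notin> later" if "j \<le> q" for j
    proof (cases "j = 0")
      case True
      then show ?thesis using False \<open>q > 0\<close> q_state unfolding later_def by force
    next
      case j: False
      then show ?thesis using False that unfolding later_def by blast
    qed
    have later_step: "take d (drop (Suc r) v) \<in> later"
      if "take d (drop r v) \<in> later \<or> r = 0" "r + d < length v" for r
    proof -
      obtain p where p: "p + d < length u" "take (Suc d) (drop p u) = take (Suc d) (drop r v)"
        and "q \<le> p"
      proof (cases "r = 0")
        case True
        then show ?thesis using that[of q] q f by simp
      next
        case r: False
        obtain p where p: "p + d < length u"
          "take (Suc d) (drop p u) = take (Suc d) (drop r v)"
          using same_edges_occurs[OF same_edges_sym[OF edges]] \<open>r + d < length v\<close> by metis
        then have "take d (drop p u) \<in> later"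
          using same_edge_same_ends[OF p(2)] \<open>take d (drop r v) \<in> later \<or> r = 0\<close> r by simp
        then have "q < p" using not_later[of p] by (meson not_le)
        then show ?thesis using that[of p] p by simp
      qed
      then have "take d (drop (Suc r) v) = take d (drop (Suc p) u)"
        using same_edge_same_ends[OF p(2)] by simp
      then show ?thesis using p(1) \<open>q \<le> p\<close> unfolding later_def by force
    qed
    have later_v: "take d (drop r v) \<in> later" if "0 < r" "r + d \<le> length v" for r
      using that
    proof (induction r)
      case (Suc r)
      then show ?case using later_step[of r] by (cases "r = 0") auto
    qed simp
    obtain r where r: "r + d < length v" "take (Suc d) (drop r v) = take (Suc d) u"
      using same_edges_occurs[OF edges, of 0] len by auto
    have "r > 0" using r diff by (cases r) auto
    then have "take d u \<in> later" using later_v[of r] r same_edge_same_ends[OF r(2)] by simp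
    then show ?thesis using not_later[of 0] by simp
  qed
qed

lemma same_edges_Cons:
  assumes "same_edges d (a # u) (b # v)" "take (Suc d) (a # u) = take (Suc d) (b # v)"
  shows "same_edges d u v"
  unfolding same_edges_def
proof (intro allI impI)
  fix x :: "'a list" assume x: "length x = Suc d"
  then have "x \<noteq> []" by auto
  moreover have "prefix x (a # u) \<longleftrightarrow> prefix x (b # v)"
    using prefix_iff_prefix_take[of x "Suc d"] x assms(2) by (metis order_refl)
  moreover have "occurrences (a # u) x = occurrences (b # v) x"
    using assms(1) x by (simp add: same_edges_def)
  ultimately show "occurrences u x = occurrences v x"
    by (simp add: occurrences_Cons)
qed

text \<open>
  Once the first edges agree, the first letter can be dropped: the remaining walks again have a
  common start and the same edges, and switchings of a suffix are switchings of the whole word.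
\<close>

lemma same_edges_connected:
  assumes "same_edges d u v" "take d u = take d v"
  shows "(block_swap d)\<^sup>*\<^sup>* u v"
  using assms
proof (induction v arbitrary: u)
  case Nil
  have "length u \<le> d"
    using same_edges_occurs[OF Nil(1), of 0] by (metis add_0 list.size(3) not_le not_less0)
  then show ?case using Nil(2) by simp
next
  case (Cons b v)
  note edges = Cons.prems(1) and start = Cons.prems(2)
  show ?case
  proof (cases "d < length u \<and> d < length (b # v)")
    case False
    \<comment> \<open>If one of the words has no edge, then neither has the other.\<close>
    have "\<not> d < length u \<and> \<not> d < length (b # v)"
      using False same_edges_occurs[OF edges, of 0]
        same_edges_occurs[OF same_edges_sym[OF edges], of 0]
      by (metis add_0 add_lessD1 add.commute)
    then have "u = b # v" using start by simp
    then show ?thesis by simp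
  next
    case True
    have "\<exists>w. (block_swap d)\<^sup>*\<^sup>* u w \<and> take (Suc d) w = take (Suc d) (b # v) \<and>
        same_edges d w (b # v)"
    proof (cases "take (Suc d) u = take (Suc d) (b # v)")
      case False
      then obtain w where w: "block_swap d u w" "take (Suc d) w = take (Suc d) (b # v)"
        using block_swap_first_edge[OF edges start] True by blast
      have "same_edges d w (b # v)"
        unfolding same_edges_def
      proof (intro allI impI)
        fix x :: "'a list" assume x: "length x = Suc d"
        then have "x \<noteq> []" by auto
        then show "occurrences w x = occurrences (b # v) x"
          using occurrences_block_swap[OF w(1), of x] edges x by (simp add: same_edges_def)
      qed
      then show ?thesis using w by blast
    qed (use edges in blast)
    then obtain w where w: "(block_swap d)\<^sup>*\<^sup>* u w" "take (Suc d) w = take (Suc d) (b # v)"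
      "same_edges d w (b # v)" by blast
    then obtain w' where w': "w = b # w'" by (cases w) auto
    have "same_edges d w' v" "take d w' = take d v"
      using same_edges_Cons[of d b w' b v] w(2,3) unfolding w' by auto
    then have "(block_swap d)\<^sup>*\<^sup>* w (b # v)"
      unfolding w' by (intro block_swap_rtranclp_Cons Cons.IH)
    with w(1) show ?thesis by (rule rtranclp_trans)
  qed
qed


section \<open>The characterisation\<close>

lemma switching_rel_rtrancl_iff:
  assumes "u \<in> lists \<Sigma>"
  shows "(u, v) \<in> (switching_rel \<Sigma> (Suc d))\<^sup>* \<longleftrightarrow> (block_swap d)\<^sup>*\<^sup>* u v"
proof
  assume "(u, v) \<in> (switching_rel \<Sigma> (Suc d))\<^sup>*"
  then show "(block_swap d)\<^sup>*\<^sup>* u v"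
    by (induction rule: rtrancl_induct)
      (auto simp: switching_rel_iff_block_swap intro: rtranclp.rtrancl_into_rtrancl)
next
  assume "(block_swap d)\<^sup>*\<^sup>* u v"
  then have "(u, v) \<in> (switching_rel \<Sigma> (Suc d))\<^sup>* \<and> v \<in> lists \<Sigma>"
  proof (induction rule: rtranclp_induct)
    case base
    then show ?case using assms by simp
  next
    case (step y z)
    then have "z \<in> lists \<Sigma>" using block_swap_set[OF step.hyps(2)] by (simp add: lists_eq_set)
    with step have "(y, z) \<in> switching_rel \<Sigma> (Suc d)"
      by (simp add: switching_rel_iff_block_swap)
    then show ?case using step \<open>z \<in> lists \<Sigma>\<close> by (meson rtrancl.rtrancl_into_rtrancl)
  qed
  then show "(u, v) \<in> (switching_rel \<Sigma> (Suc d))\<^sup>*" ..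
qed

theorem proposition3p3:
  fixes \<Sigma> :: "'a set" and k :: nat and u v :: "'a list"
  assumes "k \<ge> 1"
    and "finite \<Sigma>"
    and "\<Sigma> \<noteq> {}"
    and "u \<in> lists \<Sigma>"
    and "v \<in> lists \<Sigma>"
  shows "k_abelian_equiv \<Sigma> k u v \<longleftrightarrow> (u, v) \<in> (switching_rel \<Sigma> k)\<^sup>*"
proof -
  obtain d where k: "k = Suc d" using assms(1) by (cases k) auto
  have "k_abelian_equiv \<Sigma> (Suc d) u v \<longleftrightarrow> (block_swap d)\<^sup>*\<^sup>* u v"
  proof
    assume eq: "k_abelian_equiv \<Sigma> (Suc d) u v"
    have "same_edges d u v"
      unfolding same_edges_def
    proof (intro allI impI)
      fix x :: "'a list" assume x: "length x = Suc d"
      then have "x \<noteq> []" by auto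
      show "occurrences u x = occurrences v x"
      proof (cases "x \<in> lists \<Sigma>")
        case True
        then show ?thesis using eq x \<open>x \<noteq> []\<close> by (simp add: k_abelian_equiv_def)
      next
        case False
        \<comment> \<open>A word with a letter outside \<open>\<Sigma>\<close> occurs in neither.\<close>
        then have "\<not> set x \<subseteq> set u" "\<not> set x \<subseteq> set v"
          using assms(4,5) by (auto simp: lists_eq_set)
        then show ?thesis using occurrences_pos_subset by (metis gr0I)
      qed
    qed
    then show "(block_swap d)\<^sup>*\<^sup>* u v"
      using same_edges_connected same_start[OF assms(2,4,5) eq] by blast
  next
    assume "(block_swap d)\<^sup>*\<^sup>* u v"
    then show "k_abelian_equiv \<Sigma> (Suc d) u v"
      by (induction rule: rtranclp_induct)
        (auto simp: k_abelian_equiv_def occurrences_block_swap)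
  qed
  then show ?thesis
    unfolding k switching_rel_rtrancl_iff[OF assms(4)] .
qed

end
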